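(* Let $G$ be a finite directed weighted graph on nodes $\{1,\dots,n\}$ without loops with positive edge weights and adjacency matrix $A$, whose $m$ edges are labelled $1,\dots,m$. Let $L,R\in\mathbb{R}^{m\times n}$ be the source and target matrices, $Z$ the edge-weight matrix, $W$ the weighted line-graph matrix and $B$ the weighted Hashimoto matrix. Let $p_k(A)$ denote the matrix whose $(i,j)$ entry is the sum of the weights of all nonbacktracking walks of length $k$ from node $i$ to node $j$. Then for all integers $k\ge 0$, \[ L^T\sqrt{Z}\,(B^{\circ 1/2})^k\sqrt{Z}\,R = p_{k+1}(A). \]
   Context: $L_{ej}=1$ if edge $e$ starts at node $j$, else $0$; $R_{ej}=1$ if edge $e$ ends at node $j$, else $0$. $Z$ is the $m\times m$ diagonal matrix with $Z_{ee}=A_{ij}$ when edge $e$ is $(i,j)$. $W_{ef}=A_{ij}A_{jk}$ if $e=(i,j)$ and $f=(j,k)$, and $W_{ef}=0$ otherwise. $B\in\mathbb{R}^{m\times m}$ is given by $B_{ef}=0$ if $W_{ef}W_{fe}\neq 0$ and $B_{ef}=W_{ef}$ otherwise. $X^{\circ 1/2}$ is the elementwise square root; $(B^{\circ 1/2})^0=I$. A walk (node sequence $i_1,\dots,i_{\ell+1}$ with consecutive pairs being edges) has weight equal to the product of its edge weights and is nonbacktracking if it contains no consecutive subsequence $i\,j\,i$. *)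

theory Defs
  imports
    Complex_Main
    "Graph_Theory.Vertex_Walk"
    "Jordan_Normal_Form.Char_Poly"
begin

text \<open>
  A graph is a \<open>pre_digraph\<close> whose nodes are \<open>{0..<n}\<close> and whose arcs are the edge labels
  \<open>{0..<m}\<close> (both shifted to start at 0, as matrix indices do). Edge weights are given by a
  function \<open>w\<close> on pairs of nodes, of which only the values on \<open>arcs_ends G\<close> matter.
\<close>

definition adjacency_mat :: "nat \<Rightarrow> (nat, 'e) pre_digraph \<Rightarrow> (nat \<times> nat \<Rightarrow> real) \<Rightarrow> real mat" where
  "adjacency_mat n G w = mat n n (\<lambda>(i, j). if (i, j) \<in> arcs_ends G then w (i, j) else 0)"

definition source_mat :: "nat \<Rightarrow> nat \<Rightarrow> (nat, nat) pre_digraph \<Rightarrow> real mat" where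
  "source_mat m n G = mat m n (\<lambda>(e, j). if tail G e = j then 1 else 0)"

definition target_mat :: "nat \<Rightarrow> nat \<Rightarrow> (nat, nat) pre_digraph \<Rightarrow> real mat" where
  "target_mat m n G = mat m n (\<lambda>(e, j). if head G e = j then 1 else 0)"

definition edge_weight_mat :: "nat \<Rightarrow> (nat, nat) pre_digraph \<Rightarrow> real mat \<Rightarrow> real mat" where
  "edge_weight_mat m G A = mat m m (\<lambda>(e, f). if e = f then A $$ (tail G e, head G e) else 0)"

definition line_graph_mat :: "nat \<Rightarrow> (nat, nat) pre_digraph \<Rightarrow> real mat \<Rightarrow> real mat" where
  "line_graph_mat m G A = mat m m (\<lambda>(e, f).
     if head G e = tail G f
     then A $$ (tail G e, head G e) * A $$ (tail G f, head G f) else 0)"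

definition hashimoto_mat :: "nat \<Rightarrow> real mat \<Rightarrow> real mat" where
  "hashimoto_mat m W = mat m m (\<lambda>(e, f).
     if W $$ (e, f) * W $$ (f, e) \<noteq> 0 then 0 else W $$ (e, f))"

abbreviation elementwise_sqrt :: "real mat \<Rightarrow> real mat" where
  "elementwise_sqrt X \<equiv> map_mat sqrt X"

text \<open>
  The principal square root: the square root whose (complex) eigenvalues all lie in the open
  right half-plane. For diagonal matrices with positive entries it exists, is unique, and is
  obtained by taking the square roots of the entries; see \<open>principal_sqrt_diagonal\<close>.
\<close>

definition is_principal_sqrt :: "real mat \<Rightarrow> real mat \<Rightarrow> bool" where
  "is_principal_sqrt X S \<longleftrightarrow>
     S \<in> carrier_mat (dim_row X) (dim_row X) \<and> S * S = X \<and>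
     (\<forall>\<mu>. eigenvalue (map_mat complex_of_real S) \<mu> \<longrightarrow> Re \<mu> > 0)"

definition principal_sqrt :: "real mat \<Rightarrow> real mat" where
  "principal_sqrt X = (THE S. is_principal_sqrt X S)"

definition nonbacktracking :: "'a list \<Rightarrow> bool" where
  "nonbacktracking p \<longleftrightarrow> \<not> (\<exists>xs i j ys. p = xs @ [i, j, i] @ ys)"

definition walk_weight :: "('a \<times> 'a \<Rightarrow> real) \<Rightarrow> 'a list \<Rightarrow> real" where
  "walk_weight w p = prod_list (map w (vwalk_arcs p))"

definition nb_walks :: "('a, 'e) pre_digraph \<Rightarrow> nat \<Rightarrow> 'a \<Rightarrow> 'a \<Rightarrow> 'a list set" where
  "nb_walks G k i j =
     {p. vwalk p G \<and> vwalk_length p = k \<and> hd p = i \<and> last p = j \<and> nonbacktracking p}"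

definition nb_walk_mat ::
    "nat \<Rightarrow> (nat, 'e) pre_digraph \<Rightarrow> (nat \<times> nat \<Rightarrow> real) \<Rightarrow> nat \<Rightarrow> real mat" where
  "nb_walk_mat n G w k = mat n n (\<lambda>(i, j). \<Sum>p\<in>nb_walks G k i j. walk_weight w p)"

lemma is_principal_sqrt_diagonal:
  fixes X :: "real mat"
  assumes X: "X \<in> carrier_mat m m"
    and diag: "\<And>i j. i < m \<Longrightarrow> j < m \<Longrightarrow> i \<noteq> j \<Longrightarrow> X $$ (i, j) = 0"
    and pos: "\<And>i. i < m \<Longrightarrow> X $$ (i, i) > 0"
  shows "is_principal_sqrt X (elementwise_sqrt X)"
proof -
  have "elementwise_sqrt X * elementwise_sqrt X = X"
  proof (rule eq_matI)
    fix i j assume "i < dim_row X" "j < dim_col X"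
    then have ij: "i < m" "j < m" using X by auto
    have "(elementwise_sqrt X * elementwise_sqrt X) $$ (i, j)
        = (\<Sum>k<m. sqrt (X $$ (i, k)) * sqrt (X $$ (k, j)))"
      using X ij by (auto simp: scalar_prod_def atLeast0LessThan intro!: sum.cong)
    also have "\<dots> = (\<Sum>k<m. if k = i then sqrt (X $$ (i, i)) * sqrt (X $$ (i, j)) else 0)"
      using ij by (intro sum.cong) (auto simp: diag)
    also have "\<dots> = sqrt (X $$ (i, i)) * sqrt (X $$ (i, j))"
      using ij by simp
    also have "\<dots> = X $$ (i, j)"
      using ij diag pos[of i] by (cases "i = j") auto
    finally show "(elementwise_sqrt X * elementwise_sqrt X) $$ (i, j) = X $$ (i, j)" .
  qed (use X in auto)
  moreover have "Re \<mu> > 0"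
    if ev: "eigenvalue (map_mat complex_of_real (elementwise_sqrt X)) \<mu>" for \<mu>
  proof -
    let ?S = "map_mat complex_of_real (elementwise_sqrt X)"
    obtain v where v: "v \<in> carrier_vec m" "v \<noteq> 0\<^sub>v m" "?S *\<^sub>v v = \<mu> \<cdot>\<^sub>v v"
      using ev X unfolding eigenvalue_def eigenvector_def by auto
    then obtain i where i: "i < m" "v $ i \<noteq> 0" by (metis carrier_vecD eq_vecI index_zero_vec)
    have "(?S *\<^sub>v v) $ i = (\<Sum>k<m. complex_of_real (sqrt (X $$ (i, k))) * v $ k)"
      using X i v(1) by (auto simp: scalar_prod_def atLeast0LessThan intro!: sum.cong)
    also have "\<dots> = (\<Sum>k<m. if k = i then complex_of_real (sqrt (X $$ (i, i))) * v $ i else 0)"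
      using i by (intro sum.cong) (auto simp: diag)
    also have "\<dots> = complex_of_real (sqrt (X $$ (i, i))) * v $ i"
      using i by simp
    finally have "\<mu> = complex_of_real (sqrt (X $$ (i, i)))" using v i by simp
    then show ?thesis using pos[OF i(1)] by simp
  qed
  ultimately show ?thesis using X unfolding is_principal_sqrt_def by auto
qed

lemma principal_sqrt_diagonal_unique:
  fixes X :: "real mat"
  assumes X: "X \<in> carrier_mat m m"
    and diag: "\<And>i j. i < m \<Longrightarrow> j < m \<Longrightarrow> i \<noteq> j \<Longrightarrow> X $$ (i, j) = 0"
    and pos: "\<And>i. i < m \<Longrightarrow> X $$ (i, i) > 0"
    and S: "is_principal_sqrt X S"
  shows "S = elementwise_sqrt X"
proof (rule eq_matI)
  have Sc: "S \<in> carrier_mat m m" and SS: "S * S = X"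
    and ev: "\<And>\<mu>. eigenvalue (map_mat complex_of_real S) \<mu> \<Longrightarrow> Re \<mu> > 0"
    using S X unfolding is_principal_sqrt_def by auto
  show "dim_row S = dim_row (elementwise_sqrt X)" "dim_col S = dim_col (elementwise_sqrt X)"
    using Sc X by auto
  fix i j assume "i < dim_row (elementwise_sqrt X)" "j < dim_col (elementwise_sqrt X)"
  then have ij: "i < m" "j < m" using X by auto
  define z where "z = sqrt (X $$ (j, j))"
  have z: "z > 0" "z * z = X $$ (j, j)" using pos[OF ij(2)] by (auto simp: z_def)
  define v where "v = vec m (\<lambda>k. S $$ (k, j) - (if k = j then z else 0))"
  have vc: "v \<in> carrier_vec m" by (simp add: v_def)
  have Sv: "S *\<^sub>v v = - z \<cdot>\<^sub>v v"
  proof (rule eq_vecI)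
    fix k assume "k < dim_vec (- z \<cdot>\<^sub>v v)"
    then have k: "k < m" using vc by auto
    have "(S *\<^sub>v v) $ k
        = (\<Sum>l<m. S $$ (k, l) * (S $$ (l, j) - (if l = j then z else 0)))"
      using Sc k by (auto simp: v_def scalar_prod_def atLeast0LessThan intro!: sum.cong)
    also have "\<dots> = (\<Sum>l<m. S $$ (k, l) * S $$ (l, j) - (if l = j then S $$ (k, j) * z else 0))"
      by (intro sum.cong) (auto simp: algebra_simps)
    also have "\<dots> = (\<Sum>l<m. S $$ (k, l) * S $$ (l, j)) - S $$ (k, j) * z"
      using ij by (simp add: sum_subtractf)
    also have "(\<Sum>l<m. S $$ (k, l) * S $$ (l, j)) = (S * S) $$ (k, j)"
      using Sc k ij by (auto simp: scalar_prod_def atLeast0LessThan intro!: sum.cong)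
    also have "(S * S) $$ (k, j) = (if k = j then z * z else 0)"
      using SS diag k ij z by auto
    finally show "(S *\<^sub>v v) $ k = (- z \<cdot>\<^sub>v v) $ k"
      using k by (auto simp: v_def algebra_simps)
  qed (use Sc vc in auto)
  have "v = 0\<^sub>v m"
  proof (rule ccontr)
    assume v0: "v \<noteq> 0\<^sub>v m"
    have "eigenvector S v (- z)"
      using Sc vc Sv v0 unfolding eigenvector_def by auto
    then have "eigenvector (map_mat complex_of_real S) (map_vec complex_of_real v)
        (complex_of_real (- z))"
      using Sc by (metis of_real_hom.eigenvector_hom)
    then have "Re (complex_of_real (- z)) > 0" by (intro ev) (auto simp: eigenvalue_def)
    then show False using z by simp
  qed
  then have "v $ i = 0" using ij by simp
  then have "S $$ (i, j) = (if i = j then z else 0)" using ij by (simp add: v_def)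
  then show "S $$ (i, j) = elementwise_sqrt X $$ (i, j)"
    using ij X diag by (auto simp: z_def)
qed

lemma principal_sqrt_diagonal:
  fixes X :: "real mat"
  assumes "X \<in> carrier_mat m m"
    and "\<And>i j. i < m \<Longrightarrow> j < m \<Longrightarrow> i \<noteq> j \<Longrightarrow> X $$ (i, j) = 0"
    and "\<And>i. i < m \<Longrightarrow> X $$ (i, i) > 0"
  shows "principal_sqrt X = elementwise_sqrt X"
  unfolding principal_sqrt_def
  using is_principal_sqrt_diagonal[of X m] principal_sqrt_diagonal_unique[of X m] assms
  by (intro the_equality) blast+

end

theory Submission
  imports Defs
begin

text \<open>
  Conjugating by \<open>sqrt Z\<close> turns the symmetric weights \<open>sqrt (a e) * sqrt (a f)\<close> of the square-rooted
  Hashimoto matrix into one factor \<open>a e\<close> per edge traversed. Hence \<open>sqrt Z\<close> times the column \<open>j\<close> of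
  \<open>(elementwise_sqrt B ^\<^sub>m k) * sqrt Z * R\<close> has as its \<open>e\<close>-th entry the total weight of the
  nonbacktracking walks of length \<open>k + 1\<close> that start with the edge \<open>e\<close> and end in \<open>j\<close>: both sides
  satisfy the same recursion in \<open>k\<close>, which peels off the first edge. Multiplying by the transpose
  of \<open>L\<close> sums over the first edge.
\<close>

section \<open>Nonbacktracking walks sorted by their first edge\<close>

definition nb_walks_via :: "('a, 'e) pre_digraph \<Rightarrow> nat \<Rightarrow> 'e \<Rightarrow> 'a \<Rightarrow> 'a list set" where
  "nb_walks_via G k e j = {p \<in> nb_walks G (k + 1) (tail G e) j. hd (tl p) = head G e}"

lemma nonbacktracking_short: "length p \<le> 2 \<Longrightarrow> nonbacktracking p"
  by (auto simp: nonbacktracking_def)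

text \<open>A pattern \<open>[i, j, i]\<close> either sits at the very front or lies in the tail. So
  prepending a node costs a single local test, which can be matched with the zeros of the Hashimoto
  matrix.\<close>

lemma nonbacktracking_Cons3:
  "nonbacktracking (x # y # z # p) \<longleftrightarrow> x \<noteq> z \<and> nonbacktracking (y # z # p)"
  unfolding nonbacktracking_def
proof (intro iffI conjI notI)
  assume nb: "\<not> (\<exists>xs i j ys. x # y # z # p = xs @ [i, j, i] @ ys)"
  show False if "x = z" using nb that by (metis append_Cons append_Nil)
  show False if "\<exists>xs i j ys. y # z # p = xs @ [i, j, i] @ ys" using nb that by (metis append_Cons)
next
  assume nb: "x \<noteq> z \<and> \<not> (\<exists>xs i j ys. y # z # p = xs @ [i, j, i] @ ys)"
  assume "\<exists>xs i j ys. x # y # z # p = xs @ [i, j, i] @ ys"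
  then obtain xs i j ys where "x # y # z # p = xs @ [i, j, i] @ ys" by blast
  then show False using nb by (cases xs) auto
qed

text \<open>Sums over infinite sets default to 0, so splitting walk sums requires
  finiteness.\<close>

lemma (in fin_digraph) finite_nb_walks: "finite (nb_walks G k i j)"
proof (rule finite_subset)
  show "nb_walks G k i j \<subseteq> {p. set p \<subseteq> verts G \<and> length p \<le> Suc k}"
    by (auto simp: nb_walks_def vwalk_def)
  show "finite {p. set p \<subseteq> verts G \<and> length p \<le> Suc k}"
    by (rule finite_lists_length_le) simp
qed

lemma (in fin_digraph) finite_nb_walks_via: "finite (nb_walks_via G k e j)"
  using finite_nb_walks by (simp add: nb_walks_via_def)

text \<open>Walks are node lists, so a first edge is visible only through its two end nodes. The
  index \<open>k\<close> counts the edges after \<open>e\<close>, in step with the exponent of the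
  matrix power.\<close>

lemma mem_nb_walks_via_iff:
  "p \<in> nb_walks_via G k e j \<longleftrightarrow>
    (\<exists>q. p = tail G e # head G e # q \<and> length q = k \<and> vwalk p G \<and> last p = j \<and> nonbacktracking p)"
proof
  assume p: "p \<in> nb_walks_via G k e j"
  then have "length p = Suc (Suc k)" by (auto simp: nb_walks_via_def nb_walks_def)
  then obtain x y q where "p = x # y # q" "length q = k" by (auto simp: length_Suc_conv)
  then show "\<exists>q. p = tail G e # head G e # q \<and> length q = k \<and> vwalk p G \<and> last p = j \<and> nonbacktracking p"
    using p by (auto simp: nb_walks_via_def nb_walks_def)
qed (auto simp: nb_walks_via_def nb_walks_def)

lemma vwalk_Cons2:
  "vwalk (x # y # p) G \<longleftrightarrow> x \<in> verts G \<and> (x, y) \<in> arcs_ends G \<and> vwalk (y # p) G"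
  by (auto simp: vwalk_def)

lemma (in wf_digraph) nb_walks_via_0:
  assumes "e \<in> arcs G"
  shows "nb_walks_via G 0 e j = (if head G e = j then {[tail G e, head G e]} else {})"
  using assms
  by (auto simp: mem_nb_walks_via_iff vwalk_def nonbacktracking_short arcs_ends_conv)

text \<open>The second and third nodes of the walk supply the next edge \<open>f\<close>. For
  positive weights, the two conditions on \<open>f\<close> say exactly that the entry of
  \<open>B\<close> at \<open>(e, f)\<close> is nonzero.\<close>

lemma (in wf_digraph) nb_walks_via_Suc:
  assumes "e \<in> arcs G"
  shows "nb_walks_via G (Suc k) e j =
    (\<Union>f\<in>{f \<in> arcs G. head G e = tail G f \<and> head G f \<noteq> tail G e}. (#) (tail G e) ` nb_walks_via G k f j)"
    (is "?l = ?r")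
proof (intro subset_antisym subsetI)
  fix p assume "p \<in> ?l"
  then obtain z q where p: "p = tail G e # head G e # z # q" "length q = k" "vwalk p G"
    "last p = j" "nonbacktracking p"
    by (auto simp: mem_nb_walks_via_iff length_Suc_conv)
  then have "(head G e, z) \<in> arcs_ends G" by (simp add: vwalk_Cons2)
  then obtain f where f: "f \<in> arcs G" "tail G f = head G e" "head G f = z"
    by (auto simp: arcs_ends_conv)
  have "tl p \<in> nb_walks_via G k f j"
    using p f by (auto simp: mem_nb_walks_via_iff vwalk_Cons2 nonbacktracking_Cons3)
  moreover have "p = tail G e # tl p" "head G f \<noteq> tail G e"
    using p f by (auto simp: nonbacktracking_Cons3)
  ultimately show "p \<in> ?r" using f by (intro UN_I[of f] image_eqI) auto
next
  fix p assume "p \<in> ?r"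
  then obtain f where f: "f \<in> arcs G" "head G e = tail G f" "head G f \<noteq> tail G e"
    and "p \<in> (#) (tail G e) ` nb_walks_via G k f j" by blast
  then obtain q where "p = tail G e # tail G f # head G f # q" "length q = k"
    "vwalk (tail G f # head G f # q) G" "last p = j" "nonbacktracking (tail G f # head G f # q)"
    by (auto simp: mem_nb_walks_via_iff)
  \<comment> \<open>This pair consists of the ends of \<open>e\<close> itself, because
    \<open>f\<close> starts where \<open>e\<close> ends.\<close>
  moreover have "(tail G e, tail G f) \<in> arcs_ends G"
    using assms by (auto simp: arcs_ends_conv simp flip: f(2))
  ultimately show "p \<in> ?l"
    using f assms by (auto simp: mem_nb_walks_via_iff vwalk_Cons2 nonbacktracking_Cons3)
qed

lemma (in wf_digraph) nb_walks_Suc_eq_UN_via: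
  "nb_walks G (Suc k) i j = (\<Union>e\<in>{e \<in> arcs G. tail G e = i}. nb_walks_via G k e j)"
proof (intro subset_antisym subsetI)
  fix p assume p: "p \<in> nb_walks G (Suc k) i j"
  then have "length p = Suc (Suc k)" by (auto simp: nb_walks_def)
  then obtain x y q where q: "p = x # y # q" by (auto simp: length_Suc_conv)
  with p have "(i, y) \<in> arcs_ends G" by (auto simp: nb_walks_def vwalk_Cons2)
  then obtain e where "e \<in> arcs G" "tail G e = i" "head G e = y" by (auto simp: arcs_ends_conv)
  then show "p \<in> (\<Union>e\<in>{e \<in> arcs G. tail G e = i}. nb_walks_via G k e j)"
    using p q by (auto simp: nb_walks_via_def)
qed (auto simp: nb_walks_via_def)

text \<open>Without parallel arcs the first two nodes determine the first edge; otherwise one node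
  list would be counted under several edges.\<close>

lemma (in nomulti_digraph) nb_walks_via_disjoint:
  assumes "e \<in> arcs G" "f \<in> arcs G" "e \<noteq> f"
  shows "nb_walks_via G k e j \<inter> nb_walks_via G k f j = {}"
  using assms no_multi_arcs[of e f] by (auto simp: mem_nb_walks_via_iff arc_to_ends_def)

section \<open>Recursion for the weight sums\<close>

lemma (in wf_digraph) sum_weight_via_0:
  assumes "e \<in> arcs G"
  shows "sum (walk_weight w) (nb_walks_via G 0 e j) =
    (if head G e = j then w (tail G e, head G e) else 0)"
  using assms by (simp add: nb_walks_via_0 walk_weight_def)

text \<open>Summing over all arcs with a conditional, instead of over the admissible ones, gives the
  shape of an entry of a matrix product.\<close>

lemma (in digraph) sum_weight_via_Suc:
  assumes e: "e \<in> arcs G"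
  shows "sum (walk_weight w) (nb_walks_via G (Suc k) e j) =
    (\<Sum>f\<in>arcs G. if head G e = tail G f \<and> head G f \<noteq> tail G e
      then w (tail G e, head G e) * sum (walk_weight w) (nb_walks_via G k f j) else 0)"
proof -
  let ?F = "{f \<in> arcs G. head G e = tail G f \<and> head G f \<noteq> tail G e}"
  have "sum (walk_weight w) (nb_walks_via G (Suc k) e j) =
      (\<Sum>f\<in>?F. sum (walk_weight w) ((#) (tail G e) ` nb_walks_via G k f j))"
    unfolding nb_walks_via_Suc[OF e]
  proof (rule sum.UNION_disjoint)
    show "\<forall>f\<in>?F. \<forall>g\<in>?F. f \<noteq> g \<longrightarrow>
        (#) (tail G e) ` nb_walks_via G k f j \<inter> (#) (tail G e) ` nb_walks_via G k g j = {}"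
      by (auto dest: nb_walks_via_disjoint)
  qed (auto simp: finite_nb_walks_via)
  also have "\<dots> = (\<Sum>f\<in>?F. w (tail G e, head G e) * sum (walk_weight w) (nb_walks_via G k f j))"
  proof (intro sum.cong refl)
    fix f assume f: "f \<in> ?F"
    have "sum (walk_weight w) ((#) (tail G e) ` nb_walks_via G k f j) =
        (\<Sum>p\<in>nb_walks_via G k f j. walk_weight w (tail G e # p))"
      by (subst sum.reindex) auto
    \<comment> \<open>As \<open>p\<close> begins with \<open>tail G f\<close>, which is
      \<open>head G e\<close>, the only arc gained by prepending \<open>tail G e\<close> is that of
      \<open>e\<close>.\<close>
    also have "\<dots> = (\<Sum>p\<in>nb_walks_via G k f j. w (tail G e, head G e) * walk_weight w p)"
      using f by (intro sum.cong) (auto simp: mem_nb_walks_via_iff walk_weight_def)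
    finally show "sum (walk_weight w) ((#) (tail G e) ` nb_walks_via G k f j) =
        w (tail G e, head G e) * sum (walk_weight w) (nb_walks_via G k f j)"
      by (simp add: sum_distrib_left)
  qed
  also have "\<dots> = (\<Sum>f\<in>arcs G. if head G e = tail G f \<and> head G f \<noteq> tail G e
      then w (tail G e, head G e) * sum (walk_weight w) (nb_walks_via G k f j) else 0)"
    by (rule sum.inter_filter) simp
  finally show ?thesis .
qed

lemma (in digraph) sum_weight_eq_sum_via:
  "sum (walk_weight w) (nb_walks G (Suc k) i j) =
    (\<Sum>e\<in>arcs G. if tail G e = i then sum (walk_weight w) (nb_walks_via G k e j) else 0)"
proof -
  have "sum (walk_weight w) (nb_walks G (Suc k) i j) =
      (\<Sum>e\<in>{e \<in> arcs G. tail G e = i}. sum (walk_weight w) (nb_walks_via G k e j))"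
    unfolding nb_walks_Suc_eq_UN_via
    by (rule sum.UNION_disjoint) (auto simp: finite_nb_walks_via dest: nb_walks_via_disjoint)
  also have "\<dots> = (\<Sum>e\<in>arcs G. if tail G e = i then sum (walk_weight w) (nb_walks_via G k e j) else 0)"
    by (rule sum.inter_filter) simp
  finally show ?thesis .
qed

section \<open>Matrix powers and entries of products\<close>

lemma pow_mat_Suc_left:
  fixes M :: "'a :: semiring_1 mat"
  assumes M: "M \<in> carrier_mat m m"
  shows "M ^\<^sub>m Suc k = M * M ^\<^sub>m k"
proof (induction k)
  case (Suc k)
  have "M ^\<^sub>m Suc (Suc k) = M * M ^\<^sub>m k * M" using Suc by simp
  then show ?case using M by (simp add: assoc_mult_mat[of _ m m _ m _ m])
qed (use M in simp)

lemma mult_mat_index_sum: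
  assumes "P \<in> carrier_mat a b" "Q \<in> carrier_mat b c" "i < a" "j < c"
  shows "(P * Q) $$ (i, j) = (\<Sum>l = 0..<b. P $$ (i, l) * Q $$ (l, j))"
  using assms by (auto simp: scalar_prod_def intro!: sum.cong)

lemma diagonal_mult_mat_index:
  fixes D :: "'a :: semiring_0 mat"
  assumes D: "D \<in> carrier_mat m m" and Q: "Q \<in> carrier_mat m c" and ij: "i < m" "j < c"
    and diag: "\<And>l. l < m \<Longrightarrow> l \<noteq> i \<Longrightarrow> D $$ (i, l) = 0"
  shows "(D * Q) $$ (i, j) = D $$ (i, i) * Q $$ (i, j)"
proof -
  have "(D * Q) $$ (i, j) = (\<Sum>l = 0..<m. if l = i then D $$ (i, i) * Q $$ (i, j) else 0)"
    unfolding mult_mat_index_sum[OF D Q ij] using diag by (intro sum.cong) auto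
  then show ?thesis using ij by simp
qed

section \<open>Entries of the matrix product as walk sums\<close>

theorem theorem4p5:
  fixes G :: "(nat, nat) pre_digraph"
    and w :: "nat \<times> nat \<Rightarrow> real"
    and n m k :: nat
    and A L R Z W B :: "real mat"
  assumes "digraph G"
    and "verts G = {0..<n}"
    and "arcs G = {0..<m}"
    and "\<And>i j. (i, j) \<in> arcs_ends G \<Longrightarrow> w (i, j) > 0"
    and "A = adjacency_mat n G w"
    and "L = source_mat m n G"
    and "R = target_mat m n G"
    and "Z = edge_weight_mat m G A"
    and "W = line_graph_mat m G A"
    and "B = hashimoto_mat m W"
  shows "transpose_mat L * principal_sqrt Z * (elementwise_sqrt B ^\<^sub>m k) * principal_sqrt Z * R
    = nb_walk_mat n G w (k + 1)"
proof -
  interpret digraph G by fact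
  define a where "a e = w (tail G e, head G e)" for e
  define S where "S = elementwise_sqrt Z"
  define C where "C = elementwise_sqrt B"
  have arc: "(tail G e, head G e) \<in> arcs_ends G" if "e < m" for e
    using that assms(3) by (auto simp: arcs_ends_conv)
  have a_pos: "a e > 0" if "e < m" for e using assms(4)[OF arc[OF that]] by (simp add: a_def)
  have A_entry: "A $$ (tail G e, head G e) = a e" if "e < m" for e
  proof -
    have "tail G e < n" "head G e < n"
      using that tail_in_verts[of e] head_in_verts[of e] assms(2,3) by auto
    then show ?thesis using arc[OF that] by (simp add: assms(5) adjacency_mat_def a_def)
  qed
  have Z_entry: "Z $$ (e, f) = (if e = f then a e else 0)" if "e < m" "f < m" for e f
    using that by (simp add: assms(8) edge_weight_mat_def A_entry)
  have Z: "Z \<in> carrier_mat m m" by (simp add: assms(8) edge_weight_mat_def)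
  have sqrt_Z: "principal_sqrt Z = S"
    unfolding S_def by (rule principal_sqrt_diagonal[OF Z]) (auto simp: Z_entry a_pos)
  have S: "S \<in> carrier_mat m m" using Z by (simp add: S_def)
  have S_entry: "S $$ (e, f) = (if e = f then sqrt (a e) else 0)" if "e < m" "f < m" for e f
    using that Z by (simp add: S_def Z_entry)
  have C: "C \<in> carrier_mat m m" by (simp add: C_def assms(10) hashimoto_mat_def)
  have W_entry: "W $$ (e, f) = (if head G e = tail G f then a e * a f else 0)"
    if "e < m" "f < m" for e f
    using that A_entry[OF that(1)] A_entry[OF that(2)] by (auto simp: assms(9) line_graph_mat_def)
  \<comment> \<open>By positivity, \<open>W $$ (e, f)\<close> and \<open>W $$ (f, e)\<close> are
    both nonzero exactly when \<open>f\<close> reverses \<open>e\<close>. In the remaining cases the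
    square root splits over the product or is \<open>sqrt 0 = 0\<close>.\<close>
  have C_entry: "C $$ (e, f) =
      (if head G e = tail G f \<and> head G f \<noteq> tail G e then sqrt (a e) * sqrt (a f) else 0)"
    if "e < m" "f < m" for e f
    using that a_pos[of e] a_pos[of f]
    by (auto simp: C_def assms(10) hashimoto_mat_def W_entry real_sqrt_mult)
  have Lt: "transpose_mat L \<in> carrier_mat n m" and R: "R \<in> carrier_mat m n"
    by (auto simp: assms(6,7) source_mat_def target_mat_def)
  have Ck: "C ^\<^sub>m k \<in> carrier_mat m m" for k using C by simp
  \<comment> \<open>The left factor \<open>S\<close> is kept out, so that raising \<open>k\<close>
    only multiplies by \<open>C\<close>.\<close>
  define V where "V k = C ^\<^sub>m k * (S * R)" for k
  have V: "V k \<in> carrier_mat m n" for k using C S R by (auto simp: V_def)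
  have V_0: "V 0 = S * R" using C S R by (simp add: V_def)
  \<comment> \<open>Powers grow by a factor on the right, but peeling off the first edge needs the
    new factor on the left.\<close>
  have V_Suc: "V (Suc k) = C * V k" for k
    unfolding V_def pow_mat_Suc_left[OF C]
    using C Ck S R by (simp add: assoc_mult_mat[of _ m m _ m _ n])
  \<comment> \<open>The factor \<open>sqrt (a e)\<close> is the diagonal entry of the omitted
    \<open>S\<close>. The induction leaves \<open>e\<close> arbitrary because its step passes from
    \<open>e\<close> to a following edge \<open>f\<close>.\<close>
  have V_walks: "sqrt (a e) * V k $$ (e, j) = sum (walk_weight w) (nb_walks_via G k e j)"
    if "e < m" "j < n" for k e j
    using that(1)
  proof (induction k arbitrary: e)
    case 0
    \<comment> \<open>The right-hand \<open>S\<close> supplies the second \<open>sqrt (a e)\<close>,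
      so a one-edge walk gets its full weight.\<close>
    then have "V 0 $$ (e, j) = sqrt (a e) * R $$ (e, j)"
      using that S R by (simp add: V_0 diagonal_mult_mat_index S_entry del: index_mult_mat)
    then show ?case
      using 0 that assms(3) a_pos[of e]
      by (auto simp: sum_weight_via_0 assms(7) target_mat_def simp flip: a_def)
  next
    case (Suc k)
    have "sqrt (a e) * V (Suc k) $$ (e, j) = (\<Sum>f = 0..<m. sqrt (a e) * (C $$ (e, f) * V k $$ (f, j)))"
      unfolding V_Suc mult_mat_index_sum[OF C V Suc.prems that(2)] by (rule sum_distrib_left)
    also have "\<dots> = (\<Sum>f = 0..<m. if head G e = tail G f \<and> head G f \<noteq> tail G e
        then a e * sum (walk_weight w) (nb_walks_via G k f j) else 0)"
    proof (intro sum.cong refl)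
      fix f assume f: "f \<in> {0..<m}"
      \<comment> \<open>The outer root pairs with the one from \<open>C\<close> to give
        \<open>a e\<close>, while \<open>sqrt (a f)\<close> is exactly the factor that the induction
        hypothesis at \<open>f\<close> needs.\<close>
      have "sqrt (a e) * (sqrt (a e) * sqrt (a f) * V k $$ (f, j)) =
          (sqrt (a e) * sqrt (a e)) * (sqrt (a f) * V k $$ (f, j))"
        by (simp only: mult_ac)
      also have "\<dots> = a e * sum (walk_weight w) (nb_walks_via G k f j)"
        using a_pos[OF Suc.prems] Suc.IH[of f] f by simp
      finally show "sqrt (a e) * (C $$ (e, f) * V k $$ (f, j)) =
          (if head G e = tail G f \<and> head G f \<noteq> tail G e
           then a e * sum (walk_weight w) (nb_walks_via G k f j) else 0)"
        using f Suc.prems by (simp add: C_entry)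
    qed
    also have "\<dots> = sum (walk_weight w) (nb_walks_via G (Suc k) e j)"
      unfolding a_def using Suc.prems assms(3) by (subst sum_weight_via_Suc) auto
    finally show ?case .
  qed
  have "transpose_mat L * S * C ^\<^sub>m k * S * R = transpose_mat L * (S * V k)"
  proof -
    have LS: "transpose_mat L * S \<in> carrier_mat n m" and SR: "S * R \<in> carrier_mat m n"
      using Lt S R by (meson mult_carrier_mat)+
    have LSC: "transpose_mat L * S * C ^\<^sub>m k \<in> carrier_mat n m"
      using LS Ck by (meson mult_carrier_mat)
    have "transpose_mat L * S * C ^\<^sub>m k * S * R = transpose_mat L * S * C ^\<^sub>m k * (S * R)"
      by (rule assoc_mult_mat[OF LSC S R])
    also have "\<dots> = transpose_mat L * S * V k"
      unfolding V_def by (rule assoc_mult_mat[OF LS Ck SR])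
    also have "\<dots> = transpose_mat L * (S * V k)"
      by (rule assoc_mult_mat[OF Lt S V])
    finally show ?thesis .
  qed
  also have "\<dots> = nb_walk_mat n G w (k + 1)"
  proof (rule eq_matI)
    fix i j assume "i < dim_row (nb_walk_mat n G w (k + 1))" "j < dim_col (nb_walk_mat n G w (k + 1))"
    then have ij: "i < n" "j < n" by (auto simp: nb_walk_mat_def)
    have SV: "S * V k \<in> carrier_mat m n" using S V by auto
    have "(transpose_mat L * (S * V k)) $$ (i, j) =
        (\<Sum>e = 0..<m. transpose_mat L $$ (i, e) * (S * V k) $$ (e, j))"
      by (rule mult_mat_index_sum[OF Lt SV ij])
    also have "\<dots> = (\<Sum>e\<in>arcs G. if tail G e = i then sum (walk_weight w) (nb_walks_via G k e j) else 0)"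
    proof (intro sum.cong)
      fix e assume "e \<in> arcs G"
      then have e: "e < m" using assms(3) by simp
      \<comment> \<open>The left \<open>S\<close> restores the factor \<open>sqrt (a e)\<close>; row
        \<open>i\<close> of the transpose of \<open>L\<close> then selects the edges leaving
        \<open>i\<close>.\<close>
      have "(S * V k) $$ (e, j) = sum (walk_weight w) (nb_walks_via G k e j)"
        using e ij V_walks[OF e ij(2)]
        by (subst diagonal_mult_mat_index[OF S V]) (auto simp: S_entry)
      then show "transpose_mat L $$ (i, e) * (S * V k) $$ (e, j) =
          (if tail G e = i then sum (walk_weight w) (nb_walks_via G k e j) else 0)"
        using e ij by (simp add: assms(6) source_mat_def del: index_mult_mat)
    qed (simp add: assms(3))
    also have "\<dots> = nb_walk_mat n G w (k + 1) $$ (i, j)"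
      using ij by (simp add: nb_walk_mat_def sum_weight_eq_sum_via)
    finally show "(transpose_mat L * (S * V k)) $$ (i, j) = nb_walk_mat n G w (k + 1) $$ (i, j)" .
  qed (use Lt V in \<open>auto simp: nb_walk_mat_def\<close>)
  finally show ?thesis unfolding sqrt_Z C_def .
qed

end
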